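(* Let $n\in\{10,14,18,22,26,34,38,46,50,62\}$, write $n=4m+2$, and define the $n\times n$ array $L_n$ with rows and columns indexed by $\{0,\dots,n-1\}$ and entries in $\{0,\dots,n-1\}$ by \[ L_n[i,j]\equiv\begin{cases} i+j+1&\text{if }n-1-m\le i\le n-2\text{ and }j\in\{m,3m+1\},\\ i+j-1&\text{if }n-m\le i<n\text{ and }j\in\{m+1,3m+2\},\\ i+j+m&\text{if }i=n-1-m\text{ and }j\in\{0,m+1,2m+1,3m+2\},\\ i+j-m&\text{if }i=n-1\text{ and }j\in\{0,m,2m+1,3m+1\},\\ i+j&\text{otherwise}, \end{cases}\pmod n. \] Then $L_n$ (a latin square of order $n$) contains a triplex but no transversal.
   Context: A $k$-plex of a latin square of order $n$ is a set of $kn$ cells containing exactly $k$ cells from each row and each column, in which each symbol occurs exactly $k$ times. A transversal is a $1$-plex and a triplex is a $3$-plex. *)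

theory Defs
  imports Main
begin

text \<open>An \<open>n \<times> n\<close> array is a function \<open>nat \<Rightarrow> nat \<Rightarrow> nat\<close> (row, column, symbol) of which only the
  values at indices below \<open>n\<close> matter; the symbols are \<open>0, \<dots>, n - 1\<close>.\<close>

definition latin_square :: "nat \<Rightarrow> (nat \<Rightarrow> nat \<Rightarrow> nat) \<Rightarrow> bool" where
  "latin_square n A \<longleftrightarrow>
     (\<forall>i<n. bij_betw (\<lambda>j. A i j) {..<n} {..<n}) \<and>
     (\<forall>j<n. bij_betw (\<lambda>i. A i j) {..<n} {..<n})"

definition plex :: "nat \<Rightarrow> nat \<Rightarrow> (nat \<Rightarrow> nat \<Rightarrow> nat) \<Rightarrow> (nat \<times> nat) set \<Rightarrow> bool" where
  "plex k n A K \<longleftrightarrow>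
     K \<subseteq> {..<n} \<times> {..<n} \<and> card K = k * n \<and>
     (\<forall>r<n. card {(i, j) \<in> K. i = r} = k) \<and>
     (\<forall>c<n. card {(i, j) \<in> K. j = c} = k) \<and>
     (\<forall>s<n. card {(i, j) \<in> K. A i j = s} = k)"

abbreviation transversal :: "nat \<Rightarrow> (nat \<Rightarrow> nat \<Rightarrow> nat) \<Rightarrow> (nat \<times> nat) set \<Rightarrow> bool" where
  "transversal \<equiv> plex 1"

abbreviation triplex :: "nat \<Rightarrow> (nat \<Rightarrow> nat \<Rightarrow> nat) \<Rightarrow> (nat \<times> nat) set \<Rightarrow> bool" where
  "triplex \<equiv> plex 3"

text \<open>The array is used with \<open>n = 4 * m + 2\<close> and \<open>m > 0\<close>. Then the four special cases are mutually
  exclusive, and no natural-number subtraction below truncates: \<open>i \<ge> n - m > 1\<close> in the second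
  case and \<open>i = n - 1 \<ge> m\<close> in the fourth.\<close>

definition L :: "nat \<Rightarrow> nat \<Rightarrow> nat \<Rightarrow> nat \<Rightarrow> nat" where
  "L n m i j =
     (if n - 1 - m \<le> i \<and> i \<le> n - 2 \<and> j \<in> {m, 3 * m + 1} then i + j + 1
      else if n - m \<le> i \<and> i < n \<and> j \<in> {m + 1, 3 * m + 2} then i + j - 1
      else if i = n - 1 - m \<and> j \<in> {0, m + 1, 2 * m + 1, 3 * m + 2} then i + j + m
      else if i = n - 1 \<and> j \<in> {0, m, 2 * m + 1, 3 * m + 1} then i + j - m
      else i + j) mod n"

end

theory Submission
  imports Defs "HOL-Number_Theory.Cong"
begin

text \<open>Let \<open>\<Delta> (i, j)\<close> be the small integer added to \<open>i + j\<close> in the cell \<open>(i, j)\<close>. Summing row indices,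
  column indices and symbols over a transversal shows that the sum of \<open>\<Delta>\<close> over it is congruent to
  \<open>n / 2 = 2 m + 1\<close> modulo \<open>n\<close>. But at most one cell of a transversal has \<open>\<Delta> = m\<close>, at most one has
  \<open>\<Delta> = - m\<close>, and the values \<open>1\<close> and \<open>- 1\<close> each occur in only two columns, so that the sum lies
  between \<open>- (m + 2)\<close> and \<open>m + 2\<close>. A triplex also needs total \<open>\<Delta>\<close> congruent to \<open>2 m + 1\<close>, but
  it can use three cells with \<open>\<Delta> = m\<close>. For each of the ten orders a triplex was found by fixing
  cells with \<open>\<Delta>\<close>-values \<open>m, m, m, - m, 1\<close> and completing them with cells with \<open>\<Delta> = 0\<close> by local
  search.\<close>

section \<open>The array is a latin square\<close>

text \<open>Rows and columns of \<open>L\<close> are those of the addition table of the integers mod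
  \<open>n\<close> after a permutation \<open>p\<close> of the index. Adding \<open>c\<close>
  cancels mod \<open>n\<close>, and an injective self-map of a finite set is surjective.\<close>

lemma bij_betw_add_mod:
  fixes c n :: nat
  assumes maps: "\<And>x. x < n \<Longrightarrow> p x < n" and inj: "\<And>x y. x < n \<Longrightarrow> y < n \<Longrightarrow> p x = p y \<Longrightarrow> x = y"
    and f: "\<And>x. x < n \<Longrightarrow> f x = (c + p x) mod n"
  shows "bij_betw f {..<n} {..<n}"
proof -
  have "inj_on f {..<n}"
  proof (rule inj_onI)
    fix x y assume "x \<in> {..<n}" "y \<in> {..<n}" "f x = f y"
    then have "[c + p x = c + p y] (mod n)"
      by (simp add: f cong_def)
    then have "[p x = p y] (mod n)"
      by (simp add: cong_add_lcancel_nat)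
    then show "x = y"
      using \<open>x \<in> {..<n}\<close> \<open>y \<in> {..<n}\<close> maps inj cong_less_modulus_unique_nat by blast
  qed
  moreover have "f ` {..<n} \<subseteq> {..<n}"
    using f by (auto intro: mod_less_divisor)
  ultimately show ?thesis
    by (simp add: bij_betw_def endo_inj_surj)
qed

lemma bij_betw_row_L:
  assumes n: "n = 4 * m + 2" and m: "m > 0" and i: "i < n"
  shows "bij_betw (L n m i) {..<n} {..<n}"
proof -
  consider "i < 3 * m + 1" | "i = 3 * m + 1" | "3 * m + 2 \<le> i" "i \<le> 4 * m" | "i = 4 * m + 1"
    using i n by linarith
  then show ?thesis
  proof cases
    case 1
    then show ?thesis
      by (intro bij_betw_add_mod[where c = i and p = "\<lambda>j. j"]) (auto simp: L_def n)
  next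
    case 2
    \<comment> \<open>This is the 6-cycle 0, \<open>m\<close>, \<open>m + 1\<close>,
      \<open>2 * m + 1\<close>, \<open>3 * m + 1\<close>, \<open>3 * m + 2\<close>; these columns
      are distinct because \<open>m > 0\<close>.\<close>
    let ?p = "\<lambda>j. if j = 0 then m else if j = m then m + 1 else if j = m + 1 then 2 * m + 1
      else if j = 2 * m + 1 then 3 * m + 1 else if j = 3 * m + 1 then 3 * m + 2
      else if j = 3 * m + 2 then 0 else j"
    show ?thesis
    proof (rule bij_betw_add_mod[where c = i and p = ?p])
      show "?p x < n" if "x < n" for x
        using that n by auto
      show "x = y" if "?p x = ?p y" for x y
        using that m by (auto split: if_splits)
      show "L n m i x = (i + ?p x) mod n" for x
      \<comment> \<open>Only here does adding \<open>m\<close> to the column leave the range: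
        \<open>3 * m + 2 + m = n\<close>, which wraps to 0.\<close>
      proof (cases "x = 3 * m + 2")
        case True
        then have "L n m i x = (i + n) mod n"
          using 2 m by (simp add: L_def n)
        with True m show ?thesis
          by simp
      qed (use 2 m in \<open>auto simp: L_def n\<close>)
    qed
  next
    case 3
    \<comment> \<open>Two transpositions of adjacent columns: the shifts 1 and -1 cancel in
      pairs.\<close>
    let ?p = "\<lambda>j. if j = m then m + 1 else if j = m + 1 then m
      else if j = 3 * m + 1 then 3 * m + 2 else if j = 3 * m + 2 then 3 * m + 1 else j"
    show ?thesis
    proof (rule bij_betw_add_mod[where c = i and p = ?p])
      show "?p x < n" if "x < n" for x
        using that n by auto
      show "x = y" if "?p x = ?p y" for x y
        using that m by (auto split: if_splits)
      show "L n m i x = (i + ?p x) mod n" for x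
        using 3 m by (auto simp: L_def n)
    qed
  next
    case 4
    \<comment> \<open>The inverse of the 6-cycle for row \<open>3 * m + 1\<close>. Column 0 is the
      one that wraps around.\<close>
    let ?p = "\<lambda>j. if j = 0 then 3 * m + 2 else if j = m then 0 else if j = m + 1 then m
      else if j = 2 * m + 1 then m + 1 else if j = 3 * m + 1 then 2 * m + 1
      else if j = 3 * m + 2 then 3 * m + 1 else j"
    show ?thesis
    proof (rule bij_betw_add_mod[where c = i and p = ?p])
      show "?p x < n" if "x < n" for x
        using that n m by auto
      show "x = y" if "?p x = ?p y" for x y
        using that m by (auto split: if_splits)
      show "L n m i x = (i + ?p x) mod n" for x
      proof (cases "x = 0")
        case True
        have "i + ?p x = (3 * m + 1) + n"
          using 4 True n by simp
        moreover have "L n m i x = (3 * m + 1) mod n"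
          using 4 True m by (simp add: L_def n)
        ultimately show ?thesis
          by (metis mod_add_self2)
      qed (use 4 m in \<open>auto simp: L_def n\<close>)
    qed
  qed
qed

lemma bij_betw_column_L:
  assumes n: "n = 4 * m + 2" and m: "m > 0"
  shows "bij_betw (\<lambda>i. L n m i j) {..<n} {..<n}"
proof -
  consider "j \<in> {0, 2 * m + 1}" | "j \<in> {m, 3 * m + 1}" | "j \<in> {m + 1, 3 * m + 2}"
    | "j \<notin> {0, m, m + 1, 2 * m + 1, 3 * m + 1, 3 * m + 2}"
    by blast
  then show ?thesis
  proof cases
    case 1
    \<comment> \<open>The shifts \<open>m\<close> and \<open>- m\<close> exchange the first and the
      last of the bottom \<open>m + 1\<close> rows.\<close>
    let ?p = "\<lambda>i. if i = 3 * m + 1 then 4 * m + 1 else if i = 4 * m + 1 then 3 * m + 1 else i"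
    show ?thesis
      by (rule bij_betw_add_mod[where c = j and p = ?p])
        (use 1 m in \<open>auto simp: L_def n add.commute split: if_splits\<close>)
  next
    case 2
    \<comment> \<open>The bottom \<open>m + 1\<close> rows are rotated by one step; the shift
      \<open>- m\<close> in the last row closes the cycle. The next case is the inverse rotation,
      closed by the shift \<open>m\<close>.\<close>
    let ?p = "\<lambda>i. if 3 * m + 1 \<le> i \<and> i \<le> 4 * m then i + 1 else if i = 4 * m + 1 then 3 * m + 1 else i"
    show ?thesis
      by (rule bij_betw_add_mod[where c = j and p = ?p])
        (use 2 m in \<open>auto simp: L_def n add.commute split: if_splits\<close>)
  next
    case 3
    let ?p = "\<lambda>i. if i = 3 * m + 1 then 4 * m + 1 else if 3 * m + 2 \<le> i then i - 1 else i"
    show ?thesis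
      by (rule bij_betw_add_mod[where c = j and p = ?p])
        (use 3 m in \<open>auto simp: L_def n add.commute split: if_splits\<close>)
  next
    case 4
    then show ?thesis
      by (intro bij_betw_add_mod[where c = j and p = "\<lambda>i. i"]) (auto simp: L_def n add.commute)
  qed
qed

lemma latin_square_L:
  assumes "n = 4 * m + 2" "m > 0"
  shows "latin_square n (L n m)"
  using bij_betw_row_L[OF assms] bij_betw_column_L[OF assms] by (simp add: latin_square_def)

section \<open>The array has no transversal\<close>

text \<open>Nonempty fibres give surjectivity, and equal cardinalities then give
  injectivity.\<close>

lemma bij_betw_if_singleton_fibres:
  assumes "card K = n" "finite K" and maps: "f ` K \<subseteq> {..<n}"
    and fibres: "\<And>v. v < n \<Longrightarrow> card {x \<in> K. f x = v} = 1"
  shows "bij_betw f K {..<n::nat}"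
proof -
  have "v \<in> f ` K" if "v < n" for v
  proof -
    have "{x \<in> K. f x = v} \<noteq> {}"
      using fibres[OF that] by force
    then show ?thesis
      by blast
  qed
  with maps have "f ` K = {..<n}"
    by blast
  with assms(1,2) show ?thesis
    by (simp add: bij_betw_def eq_card_imp_inj_on)
qed

text \<open>These bijections turn sums over the cells of a transversal into sums over
  \<open>{..<n}\<close>.\<close>

lemma transversal_bij_betw:
  assumes "transversal n A K" and A: "\<And>i j. A i j < n"
  shows "bij_betw fst K {..<n}" "bij_betw snd K {..<n}" "bij_betw (case_prod A) K {..<n}"
proof -
  have K: "K \<subseteq> {..<n} \<times> {..<n}" "card K = n"
    using assms(1) by (auto simp: plex_def)
  have "{(i, j) \<in> K. i = v} = {p \<in> K. fst p = v}" "{(i, j) \<in> K. j = v} = {p \<in> K. snd p = v}"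
    "{(i, j) \<in> K. A i j = v} = {p \<in> K. case_prod A p = v}" for v
    by auto
  then have fibres: "card {p \<in> K. fst p = v} = 1" "card {p \<in> K. snd p = v} = 1"
    "card {p \<in> K. case_prod A p = v} = 1" if "v < n" for v
    using assms(1) that by (simp_all add: plex_def)
  have "finite K"
    using K(1) by (rule finite_subset) simp
  note bij = bij_betw_if_singleton_fibres[OF K(2) this]
  show "bij_betw fst K {..<n}" "bij_betw snd K {..<n}" "bij_betw (case_prod A) K {..<n}"
    by (rule bij; use K(1) A fibres in \<open>force simp: case_prod_beta\<close>)+
qed

text \<open>The function \<open>\<Delta>\<close>; the bounds on \<open>i\<close> are those of \<^const>\<open>L\<close> with \<open>n = 4 * m + 2\<close> inserted.\<close>

definition shift :: "nat \<Rightarrow> nat \<Rightarrow> nat \<Rightarrow> int" where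
  "shift m i j =
     (if 3 * m + 1 \<le> i \<and> i \<le> 4 * m \<and> j \<in> {m, 3 * m + 1} then 1
      else if 3 * m + 2 \<le> i \<and> i \<le> 4 * m + 1 \<and> j \<in> {m + 1, 3 * m + 2} then - 1
      else if i = 3 * m + 1 \<and> j \<in> {0, m + 1, 2 * m + 1, 3 * m + 2} then int m
      else if i = 4 * m + 1 \<and> j \<in> {0, m, 2 * m + 1, 3 * m + 1} then - int m
      else 0)"

lemma int_L:
  assumes n: "n = 4 * m + 2"
  shows "int (L n m i j) = (int i + int j + shift m i j) mod int n"
proof -
  let ?a = "3 * m + 1 \<le> i \<and> i \<le> 4 * m \<and> j \<in> {m, 3 * m + 1}"
  let ?b = "3 * m + 2 \<le> i \<and> i \<le> 4 * m + 1 \<and> j \<in> {m + 1, 3 * m + 2}"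
  let ?c = "i = 3 * m + 1 \<and> j \<in> {0, m + 1, 2 * m + 1, 3 * m + 2}"
  let ?d = "i = 4 * m + 1 \<and> j \<in> {0, m, 2 * m + 1, 3 * m + 1}"
  let ?e = "if ?a then i + j + 1 else if ?b then i + j - 1 else if ?c then i + j + m
    else if ?d then i + j - m else i + j"
  have "n - 1 - m = 3 * m + 1" "n - 2 = 4 * m" "n - m = 3 * m + 2" "n - 1 = 4 * m + 1"
    "i < n \<longleftrightarrow> i \<le> 4 * m + 1"
    using n by linarith+
  then have "L n m i j = ?e mod n"
    by (simp only: L_def)
  moreover have "int ?e = int (i + j) + shift m i j"
  proof -
    \<comment> \<open>With the conditions abstracted, what remains is that neither natural-number
      subtraction truncates.\<close>
    have "int (if a then x + 1 else if b then x - 1 else if c then x + m else if d then x - m else x)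
        = int x + (if a then 1 else if b then - 1 else if c then int m else if d then - int m else 0)"
      if "b \<Longrightarrow> 1 \<le> x" "d \<Longrightarrow> m \<le> x" for a b c d x
      using that by (auto simp: of_nat_diff)
    then show ?thesis
      unfolding shift_def by this auto
  qed
  ultimately show ?thesis
    by (simp only: zmod_int of_nat_add)
qed

text \<open>The bound is a sum of indicators of one row and two columns, each met exactly once by a
  transversal, so it sums to \<open>m + 2\<close>. The companion bound for \<open>- shift\<close>
  works in the same way.\<close>

lemma shift_le:
  "shift m i j \<le> (if i = 3 * m + 1 then int m else 0)
     + (if j = m then 1 else 0) + (if j = 3 * m + 1 then 1 else 0)"
  by (auto simp: shift_def)

lemma neg_shift_le:
  "- shift m i j \<le> (if i = 4 * m + 1 then int m else 0)
     + (if j = m + 1 then 1 else 0) + (if j = 3 * m + 2 then 1 else 0)"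
  by (auto simp: shift_def)

lemma no_transversal_L:
  assumes n: "n = 4 * m + 2" and m: "2 \<le> m"
  shows "\<not> transversal n (L n m) K"
proof
  assume "transversal n (L n m) K"
  moreover have "L n m i j < n" for i j
    using n by (simp add: L_def)
  ultimately have bij: "bij_betw fst K {..<n}" "bij_betw snd K {..<n}"
    "bij_betw (case_prod (L n m)) K {..<n}"
    by (rule transversal_bij_betw)+
  let ?S = "\<Sum>v<n. int v" and ?D = "\<Sum>p\<in>K. shift m (fst p) (snd p)"
  note sum_fst = sum.reindex_bij_betw[OF bij(1)]
  note sum_snd = sum.reindex_bij_betw[OF bij(2)]
  have row: "(\<Sum>p\<in>K. if fst p = i then x else 0) = x" if "i < n" for i and x :: int
    using sum_fst[of "\<lambda>i'. if i' = i then x else 0"] that by simp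
  have column: "(\<Sum>p\<in>K. if snd p = j then x else 0) = x" if "j < n" for j and x :: int
    using sum_snd[of "\<lambda>j'. if j' = j then x else 0"] that by simp

  have "?D \<le> (\<Sum>p\<in>K. (if fst p = 3 * m + 1 then int m else 0)
      + (if snd p = m then 1 else 0) + (if snd p = 3 * m + 1 then 1 else 0))"
    by (intro sum_mono shift_le)
  also have "\<dots> = int m + 2"
    unfolding sum.distrib using row[of "3 * m + 1" "int m"] column[of m 1]
      column[of "3 * m + 1" 1] n by linarith
  finally have upper: "?D \<le> int m + 2" .

  have "- ?D \<le> (\<Sum>p\<in>K. (if fst p = 4 * m + 1 then int m else 0)
      + (if snd p = m + 1 then 1 else 0) + (if snd p = 3 * m + 2 then 1 else 0))"
    unfolding sum_negf[symmetric] by (intro sum_mono neg_shift_le)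
  also have "\<dots> = int m + 2"
    unfolding sum.distrib using row[of "4 * m + 1" "int m"] column[of "m + 1" 1]
      column[of "3 * m + 2" 1] n m by linarith
  finally have lower: "- ?D \<le> int m + 2" .

  \<comment> \<open>Symbols, rows and columns each sum to \<open>?S\<close>, so \<open>?S\<close> is
    congruent to \<open>?S + ?S + ?D\<close> mod \<open>n\<close>.\<close>
  have "?S = (\<Sum>p\<in>K. int (L n m (fst p) (snd p)))"
    using sum.reindex_bij_betw[OF bij(3), of int] by (simp add: case_prod_beta)
  also have "\<dots> mod int n = (\<Sum>p\<in>K. int (fst p) + int (snd p) + shift m (fst p) (snd p)) mod int n"
    unfolding int_L[OF n] by (rule mod_sum_eq)
  also have "(\<Sum>p\<in>K. int (fst p) + int (snd p) + shift m (fst p) (snd p)) = ?S + ?S + ?D"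
    by (simp add: sum.distrib sum_fst[of int] sum_snd[of int])
  finally have "int n dvd ?S - (?S + ?S + ?D)"
    by (simp only: mod_eq_dvd_iff)
  also have "?S - (?S + ?S + ?D) = - (?S + ?D)"
    by simp
  finally have "int n dvd ?S + ?D"
    by (simp only: dvd_minus_iff)
  moreover have "?S = int (2 * m + 1) * int (4 * m + 1)"
  proof -
    have "2 * (\<Sum>v<l. int v) = int l * (int l - 1)" for l
      by (induction l) (auto simp: algebra_simps)
    from this[of n] show ?thesis
      by (simp add: n algebra_simps)
  qed
  ultimately have "int n dvd int (2 * m + 1) * int (4 * m + 1) + ?D"
    by simp
  then obtain q where "int (2 * m + 1) * int (4 * m + 1) + ?D = int n * q"
    by (rule dvdE)
  moreover have "int n * q = int (2 * m + 1) * (2 * q)"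
    by (simp add: n algebra_simps)
  \<comment> \<open>\<open>?D\<close> is an odd multiple of \<open>n / 2 = 2 * m + 1\<close>, hence
    nonzero.\<close>
  ultimately have D: "?D = int (2 * m + 1) * (2 * q - int (4 * m + 1))"
    unfolding right_diff_distrib by linarith
  \<comment> \<open>Here \<open>2 \<le> m\<close> matters: it is equivalent to
    \<open>m + 2 < 2 * m + 1\<close>.\<close>
  have "\<bar>?D\<bar> < int (2 * m + 1)"
    using upper lower m by linarith
  moreover have "int (2 * m + 1) dvd ?D"
    unfolding D by (rule dvd_triv_left)
  ultimately have "?D = 0"
    using dvd_imp_le_int[of ?D "int (2 * m + 1)"] by linarith
  then have "int (2 * m + 1) * (2 * q - int (4 * m + 1)) = 0"
    unfolding D .
  then have "2 * q - int (4 * m + 1) = 0"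
    by (simp only: mult_eq_0_iff of_nat_eq_0_iff) simp
  then show False
    by presburger
qed

section \<open>Certificates for plexes\<close>

definition row_cells :: "nat list list \<Rightarrow> (nat \<times> nat) list" where
  "row_cells rows = concat (map (\<lambda>i. map (Pair i) (rows ! i)) [0..<length rows])"

text \<open>An executable form of a plex: \<open>rows ! i\<close> lists the columns used in row
  \<open>i\<close>. Comparing a sorted list with \<open>k\<close> copies of each number below
  \<open>n\<close> checks all column or symbol counts at once.\<close>

definition row_certificate :: "nat \<Rightarrow> nat \<Rightarrow> (nat \<Rightarrow> nat \<Rightarrow> nat) \<Rightarrow> nat list list \<Rightarrow> bool" where
  "row_certificate k n A rows \<longleftrightarrow>
     length rows = n \<and> list_all (\<lambda>r. length r = k \<and> distinct r) rows \<and>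
     sort (concat rows) = concat (map (replicate k) [0..<n]) \<and>
     sort (map (case_prod A) (row_cells rows)) = concat (map (replicate k) [0..<n])"

lemma set_row_cells: "set (row_cells rows) = (SIGMA i:{..<length rows}. set (rows ! i))"
  by (auto simp: row_cells_def)

lemma map_snd_row_cells: "map snd (row_cells rows) = concat rows"
proof -
  have "map snd (row_cells rows) = concat (map ((!) rows) [0..<length rows])"
    by (simp add: row_cells_def map_concat o_def)
  then show ?thesis
    by (simp add: map_nth)
qed

lemma distinct_row_cells:
  assumes "\<And>r. r \<in> set rows \<Longrightarrow> distinct r"
  shows "distinct (row_cells rows)"
proof -
  \<comment> \<open>Generalised to prefixes for the induction; the bound on \<open>l\<close> keeps
    \<open>rows ! i\<close> among the given rows.\<close>
  have "distinct (concat (map (\<lambda>i. map (Pair i) (rows ! i)) [0..<l]))" if "l \<le> length rows" for l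
    using that by (induction l) (auto simp: distinct_map inj_on_def assms)
  then show ?thesis
    by (simp add: row_cells_def)
qed

lemma length_filter_replicates:
  fixes v :: nat
  assumes "v < n"
  shows "length (filter (\<lambda>x. x = v) (concat (map (replicate k) [0..<n]))) = k"
proof -
  have "length (filter (\<lambda>x. x = v) (concat (map (replicate k) [0..<l]))) = (if v < l then k else 0)" for l
    by (induction l) auto
  with assms show ?thesis
    by simp
qed

text \<open>Distinctness turns the cardinality into a count in a list, which sorting
  preserves.\<close>

lemma card_fibre_if_sorted:
  fixes f :: "'a \<Rightarrow> nat"
  assumes "distinct xs" and sorted: "sort (map f xs) = concat (map (replicate k) [0..<n])" and "v < n"
  shows "card {x \<in> set xs. f x = v} = k"
proof -
  have "card {x \<in> set xs. f x = v} = length (filter (\<lambda>x. f x = v) xs)"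
    using distinct_card[OF distinct_filter[OF \<open>distinct xs\<close>]] by (metis set_filter)
  also have "\<dots> = length (filter (\<lambda>y. y = v) (map f xs))"
    by (simp add: filter_map o_def)
  also have "\<dots> = length (filter (\<lambda>y. y = v) (sort (map f xs)))"
    by (simp add: filter_sort)
  also have "\<dots> = k"
    unfolding sorted by (rule length_filter_replicates[OF \<open>v < n\<close>])
  finally show ?thesis .
qed

lemma plex_if_row_certificate:
  assumes "row_certificate k n A rows"
  shows "plex k n A (set (row_cells rows))"
proof -
  let ?K = "set (row_cells rows)"
  have len: "length rows = n"
    and row: "\<And>r. r \<in> set rows \<Longrightarrow> length r = k" "\<And>r. r \<in> set rows \<Longrightarrow> distinct r"
    and cols: "sort (concat rows) = concat (map (replicate k) [0..<n])"
    and syms: "sort (map (case_prod A) (row_cells rows)) = concat (map (replicate k) [0..<n])"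
    using assms by (auto simp: row_certificate_def list_all_iff)
  have dist: "distinct (row_cells rows)"
    using row(2) by (rule distinct_row_cells)
  have K: "?K = (SIGMA i:{..<n}. set (rows ! i))"
    by (simp add: set_row_cells len)
  have card_row: "card (set (rows ! i)) = k" if "i < n" for i
    using that len row by (metis distinct_card nth_mem)
  \<comment> \<open>The certificate has no explicit range check; the range of the columns is read
    off the sorted list.\<close>
  have "set (concat rows) \<subseteq> {..<n}"
    by (subst set_sort[symmetric], subst cols) auto
  then have "set (rows ! i) \<subseteq> {..<n}" if "i < n" for i
    using that len nth_mem by fastforce
  then have "?K \<subseteq> {..<n} \<times> {..<n}"
    unfolding K by blast
  moreover have "card ?K = k * n"
    unfolding K by (subst card_SigmaI) (simp_all add: card_row)
  moreover have "card {(i, j) \<in> ?K. i = r} = k" if "r < n" for r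
  proof -
    have "{(i, j) \<in> ?K. i = r} = Pair r ` set (rows ! r)"
      using that unfolding K by auto
    then show ?thesis
      by (simp add: card_image inj_on_def card_row that)
  qed
  moreover have "card {(i, j) \<in> ?K. j = c} = k" if "c < n" for c
  proof -
    have "{(i, j) \<in> ?K. j = c} = {p \<in> ?K. snd p = c}"
      by auto
    then show ?thesis
      using card_fibre_if_sorted[OF dist, of snd k n c] that cols by (simp add: map_snd_row_cells)
  qed
  moreover have "card {(i, j) \<in> ?K. A i j = s} = k" if "s < n" for s
  proof -
    have "{(i, j) \<in> ?K. A i j = s} = {p \<in> ?K. case_prod A p = s}"
      by auto
    then show ?thesis
      using card_fibre_if_sorted[OF dist syms that] by simp
  qed
  ultimately show ?thesis
    unfolding plex_def by blast
qed

section \<open>The triplexes\<close>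

lemma triplex_L_10: "\<exists>K. triplex 10 (L 10 2) K"
proof -
  \<comment> \<open>Row \<open>3 * m + 1 = 7\<close> uses columns 0, \<open>m + 1\<close> and
    \<open>2 * m + 1\<close>, all of shift \<open>m\<close>; cell (8, 7) has shift 1 and cell (9, 7)
    shift \<open>- m\<close>. The total is \<open>2 * m + 1 = 5\<close>. The larger orders use the
    same three columns in row \<open>3 * m + 1\<close>.\<close>
  let ?rows = "
    [[0, 1, 8], [5, 8, 9], [1, 2, 3], [4, 5, 8], [2, 3, 9], [0, 4, 6], [2, 6, 7], [0, 3, 5],
     [4, 7, 9], [1, 6, 7]]"
  have "row_certificate 3 10 (L 10 2) ?rows"
    by code_simp
  then show ?thesis
    using plex_if_row_certificate by blast
qed

lemma triplex_L_14: "\<exists>K. triplex 14 (L 14 3) K"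
proof -
  let ?rows = "
    [[2, 3, 12], [3, 6, 8], [5, 7, 13], [4, 5, 8], [1, 6, 11], [7, 8, 11], [3, 4, 9], [11,
     12, 13], [0, 6, 9], [2, 9, 10], [0, 4, 7], [0, 5, 10], [1, 2, 12], [1, 10, 13]]"
  have "row_certificate 3 14 (L 14 3) ?rows"
    by code_simp
  then show ?thesis
    using plex_if_row_certificate by blast
qed

lemma triplex_L_18: "\<exists>K. triplex 18 (L 18 4) K"
proof -
  let ?rows = "
    [[3, 5, 12], [1, 2, 5], [8, 14, 17], [1, 3, 10], [10, 12, 16], [6, 8, 14], [3, 6, 13],
     [4, 9, 11], [4, 7, 9], [0, 11, 16], [12, 14, 15], [2, 4, 7], [11, 15, 16], [0, 5, 9],
     [0, 13, 15], [2, 6, 17], [7, 10, 17], [1, 8, 13]]"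
  have "row_certificate 3 18 (L 18 4) ?rows"
    by code_simp
  then show ?thesis
    using plex_if_row_certificate by blast
qed

lemma triplex_L_22: "\<exists>K. triplex 22 (L 22 5) K"
proof -
  let ?rows = "
    [[3, 8, 15], [10, 17, 19], [4, 15, 21], [7, 13, 17], [1, 9, 18], [1, 19, 21], [1, 6, 8],
     [7, 12, 19], [5, 12, 16], [2, 14, 21], [4, 11, 17], [2, 6, 14], [0, 3, 9], [5, 13, 20],
     [4, 5, 15], [0, 8, 10], [0, 6, 11], [7, 14, 16], [11, 13, 20], [3, 9, 12], [2, 10, 18],
     [16, 18, 20]]"
  have "row_certificate 3 22 (L 22 5) ?rows"
    by code_simp
  then show ?thesis
    using plex_if_row_certificate by blast
qed

lemma triplex_L_26: "\<exists>K. triplex 26 (L 26 6) K"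
proof -
  let ?rows = "
    [[2, 15, 22], [6, 7, 16], [1, 2, 25], [2, 3, 13], [1, 6, 17], [4, 14, 18], [1, 11, 14],
     [12, 13, 21], [19, 22, 25], [4, 15, 23], [4, 8, 20], [0, 9, 15], [6, 10, 16], [3, 12,
     21], [7, 8, 12], [3, 9, 23], [9, 20, 23], [10, 20, 24], [5, 17, 18], [0, 7, 13], [11,
     19, 22], [5, 8, 24], [17, 18, 21], [0, 14, 24], [5, 10, 11], [16, 19, 25]]"
  have "row_certificate 3 26 (L 26 6) ?rows"
    by code_simp
  then show ?thesis
    using plex_if_row_certificate by blast
qed

lemma triplex_L_34: "\<exists>K. triplex 34 (L 34 8) K"
proof -
  let ?rows = "
    [[21, 25, 29], [3, 5, 13], [22, 23, 33], [11, 14, 21], [5, 6, 24], [10, 15, 26], [10,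
     26, 28], [0, 2, 8], [12, 28, 32], [1, 14, 15], [2, 9, 13], [10, 19, 29], [7, 16, 30],
     [20, 26, 28], [9, 13, 20], [2, 16, 23], [3, 30, 33], [8, 12, 31], [4, 18, 21], [8, 18,
     22], [12, 17, 27], [22, 23, 24], [6, 17, 29], [4, 31, 32], [5, 14, 32], [0, 9, 17], [7,
     11, 25], [3, 18, 19], [7, 19, 24], [1, 27, 31], [6, 15, 30], [4, 11, 16], [0, 20, 33],
     [1, 25, 27]]"
  have "row_certificate 3 34 (L 34 8) ?rows"
    by code_simp
  then show ?thesis
    using plex_if_row_certificate by blast
qed

lemma triplex_L_38: "\<exists>K. triplex 38 (L 38 9) K"
proof -
  let ?rows = "
    [[2, 8, 11], [4, 7, 9], [9, 22, 29], [13, 27, 33], [3, 15, 28], [23, 30, 32], [8, 15,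
     26], [3, 14, 24], [16, 17, 35], [11, 14, 22], [20, 24, 37], [18, 30, 31], [4, 23, 25],
     [9, 19, 37], [0, 1, 13], [0, 29, 36], [25, 29, 32], [10, 16, 30], [1, 18, 31], [1, 7,
     33], [4, 20, 34], [14, 21, 24], [7, 11, 17], [2, 5, 27], [5, 16, 31], [3, 21, 36], [10,
     12, 25], [12, 26, 34], [0, 10, 19], [15, 28, 35], [13, 20, 35], [2, 32, 33], [6, 12,
     27], [5, 6, 8], [17, 26, 34], [21, 22, 37], [6, 19, 36], [18, 23, 28]]"
  have "row_certificate 3 38 (L 38 9) ?rows"
    by code_simp
  then show ?thesis
    using plex_if_row_certificate by blast
qed

lemma triplex_L_46: "\<exists>K. triplex 46 (L 46 11) K"
proof -
  let ?rows = "
    [[1, 6, 27], [2, 3, 36], [5, 8, 39], [34, 40, 44], [5, 22, 35], [1, 41, 43], [24, 30,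
     37], [18, 38, 42], [6, 11, 31], [25, 41, 44], [8, 18, 24], [7, 14, 32], [16, 19, 33],
     [15, 31, 35], [11, 17, 26], [14, 39, 42], [1, 28, 45], [10, 21, 40], [5, 22, 45], [23,
     27, 43], [13, 24, 43], [13, 16, 29], [29, 33, 39], [9, 12, 36], [12, 18, 42], [10, 21,
     37], [0, 3, 27], [4, 11, 45], [13, 28, 41], [0, 4, 9], [2, 29, 30], [2, 9, 20], [10,
     38, 44], [6, 32, 35], [0, 12, 23], [19, 30, 34], [20, 22, 31], [14, 25, 32], [3, 17,
     28], [8, 15, 19], [33, 36, 38], [20, 26, 40], [7, 17, 25], [15, 21, 23], [4, 16, 26],
     [7, 34, 37]]"
  have "row_certificate 3 46 (L 46 11) ?rows"
    by code_simp
  then show ?thesis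
    using plex_if_row_certificate by blast
qed

lemma triplex_L_50: "\<exists>K. triplex 50 (L 50 12) K"
proof -
  let ?rows = "
    [[8, 20, 40], [3, 38, 48], [4, 33, 44], [12, 15, 36], [27, 29, 34], [9, 13, 24], [15,
     39, 47], [18, 34, 48], [13, 24, 32], [18, 28, 49], [24, 41, 49], [0, 17, 19], [1, 5,
     30], [27, 31, 48], [1, 31, 42], [5, 26, 37], [9, 42, 46], [12, 19, 46], [5, 16, 49],
     [7, 16, 45], [6, 23, 36], [10, 16, 30], [12, 26, 38], [2, 9, 25], [8, 42, 47], [17, 28,
     44], [33, 34, 43], [25, 32, 39], [18, 38, 45], [7, 14, 20], [8, 22, 27], [4, 11, 41],
     [7, 22, 40], [11, 14, 17], [11, 21, 43], [3, 44, 46], [15, 21, 29], [0, 13, 25], [3,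
     37, 40], [23, 29, 35], [14, 20, 32], [22, 23, 26], [6, 19, 28], [30, 35, 43], [33, 36,
     39], [1, 2, 10], [4, 41, 47], [0, 6, 10], [2, 21, 35], [31, 37, 45]]"
  have "row_certificate 3 50 (L 50 12) ?rows"
    by code_simp
  then show ?thesis
    using plex_if_row_certificate by blast
qed

lemma triplex_L_62: "\<exists>K. triplex 62 (L 62 15) K"
proof -
  let ?rows = "
    [[4, 8, 27], [6, 16, 21], [9, 35, 43], [2, 7, 25], [30, 31, 61], [42, 56, 59], [11, 34,
     60], [11, 28, 56], [18, 25, 47], [1, 6, 7], [10, 47, 55], [26, 37, 48], [15, 18, 34],
     [3, 7, 30], [33, 35, 47], [18, 38, 59], [22, 34, 57], [23, 45, 60], [8, 11, 46], [39,
     55, 56], [24, 55, 59], [12, 36, 44], [15, 40, 50], [5, 23, 29], [2, 4, 23], [19, 29,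
     58], [19, 45, 60], [17, 28, 36], [10, 20, 30], [13, 41, 44], [36, 38, 39], [0, 17, 52],
     [22, 25, 54], [8, 17, 35], [1, 26, 50], [3, 4, 43], [6, 24, 51], [3, 5, 43], [13, 14,
     48], [21, 42, 52], [9, 45, 54], [40, 42, 52], [9, 21, 49], [16, 24, 53], [15, 32, 37],
     [13, 39, 53], [0, 16, 31], [27, 33, 46], [14, 27, 28], [20, 33, 40], [5, 14, 48], [2,
     20, 57], [0, 19, 51], [32, 41, 58], [22, 49, 51], [1, 50, 61], [12, 31, 57], [10, 44,
     61], [12, 29, 49], [26, 37, 53], [38, 41, 58], [32, 46, 54]]"
  have "row_certificate 3 62 (L 62 15) ?rows"
    by code_simp
  then show ?thesis
    using plex_if_row_certificate by blast
qed

lemma triplex_L: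
  assumes "n \<in> {10, 14, 18, 22, 26, 34, 38, 46, 50, 62}" and "n = 4 * m + 2"
  shows "\<exists>K. triplex n (L n m) K"
proof -
  \<comment> \<open>Solving for \<open>m\<close> makes each of the ten cases a concrete
    instance.\<close>
  have m: "m = (n - 2) div 4"
    using assms(2) by simp
  show ?thesis
    using assms(1) unfolding m
    using triplex_L_10 triplex_L_14 triplex_L_18 triplex_L_22 triplex_L_26
      triplex_L_34 triplex_L_38 triplex_L_46 triplex_L_50 triplex_L_62
    by (elim insertE emptyE) simp_all
qed

theorem theorem4p1:
  fixes n m :: nat
  assumes "n \<in> {10, 14, 18, 22, 26, 34, 38, 46, 50, 62}"
    and "n = 4 * m + 2"
  shows "latin_square n (L n m) \<and>
         (\<exists>K. triplex n (L n m) K) \<and>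
         \<not> (\<exists>K. transversal n (L n m) K)"
proof -
  have "2 \<le> m"
    using assms by auto
  then show ?thesis
    using assms latin_square_L triplex_L no_transversal_L by auto
qed

end
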